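(* Let $n,k$ be positive integers with $n\ge 2k$, and let $\mathcal F\subset\binom{[n]}{k}$ be an intersecting family with $|\mathcal F|\ge 36\binom{n-3}{k-3}$. Then $\varrho(\mathcal F)>\frac12$.
   Context: $[n]=\{1,\dots,n\}$; $\binom{[n]}{k}$ is the set of $k$-subsets of $[n]$. $\mathcal F$ is intersecting if $F\cap F'\ne\emptyset$ for all $F,F'\in\mathcal F$. For $i\in[n]$, $\mathcal F(i)=\{F\setminus\{i\}: i\in F\in\mathcal F\}$, and $\varrho(\mathcal F)=\max_{i\in[n]}|\mathcal F(i)|/|\mathcal F|$. Binomial coefficients $\binom{m}{j}$ are $0$ when $j<0$ or $j>m$. *)

theory Defs
  imports Complex_Main "HOL-Library.Ramsey"
begin

text \<open>The \<open>k\<close>-subsets of \<open>[n]\<close> are \<^term>\<open>nsets {1..n} k\<close>, as defined in the Ramsey library theory.\<close>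

definition intersecting :: "'a set set \<Rightarrow> bool" where
  "intersecting \<F> \<longleftrightarrow> (\<forall>F\<in>\<F>. \<forall>F'\<in>\<F>. F \<inter> F' \<noteq> {})"

definition link :: "'a set set \<Rightarrow> 'a \<Rightarrow> 'a set set" where
  "link \<F> i = {F - {i} | F. F \<in> \<F> \<and> i \<in> F}"

text \<open>Meaningful only for \<open>n \<ge> 1\<close> and a finite nonempty family: \<open>\<varrho>\<close> of the empty family would be \<open>0 / 0\<close>,
  which is \<open>0\<close> in HOL.\<close>

definition max_degree_ratio :: "nat \<Rightarrow> nat set set \<Rightarrow> real" where
  "max_degree_ratio n \<F> = Max ((\<lambda>i. real (card (link \<F> i)) / real (card \<F>)) ` {1..n})"

text \<open>The binomial coefficient with integer arguments, zero outside \<open>0 \<le> j \<le> m\<close>. Truncated subtraction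
  on \<^typ>\<open>nat\<close> would give \<open>(n - 3) choose (k - 3) = 1\<close> for \<open>k < 3\<close> instead of \<open>0\<close>.\<close>

definition ibinomial :: "int \<Rightarrow> int \<Rightarrow> nat" where
  "ibinomial m j = (if 0 \<le> j \<and> j \<le> m then nat m choose nat j else 0)"

end

theory Submission
  imports Defs
begin

text \<open>
  Put \<open>u = (n - 3) choose (k - 3)\<close> and suppose that all degrees are at most \<open>card \<F> / 2\<close>. Shifting
  two cross-intersecting families and counting lattice paths shows that one of them is small.
  Applied to the sets containing both of two points and those containing neither, this
  bounds every codegree by \<open>2 * u\<close>. If two points \<open>a\<close>, \<open>b\<close> had degree above \<open>5 * u\<close>, the sets
  containing only \<open>a\<close> and those containing only \<open>b\<close> would be large cross-intersecting families;
  almost all their members then share a third point, which contradicts the codegree bound. So at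
  most one point \<open>z\<close> has degree above \<open>5 * u\<close>. A shift avoiding \<open>z\<close> produces degrees at most
  \<open>10 * u \<le> card \<F> / 2\<close>, so a balanced family of least weight is shifted on the complement of
  \<open>z\<close>. At least \<open>card \<F> / 2 - 10 * u\<close> of its members avoid \<open>z\<close> and the two smallest remaining
  points, but lattice paths bound their number by \<open>u\<close>.
\<close>

section \<open>Shifting of cross-intersecting families\<close>

definition cross_intersecting :: "'a set set \<Rightarrow> 'a set set \<Rightarrow> bool" where
  "cross_intersecting A B \<longleftrightarrow> (\<forall>E\<in>A. \<forall>E'\<in>B. E \<inter> E' \<noteq> {})"

definition degree :: "'a set set \<Rightarrow> 'a \<Rightarrow> nat" where
  "degree A v = card {E \<in> A. v \<in> E}"

text \<open>Moving \<open>j\<close> to \<open>i\<close> is suppressed when the result is already a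
  member of \<open>A\<close>. This makes the map injective on \<open>A\<close>, so a shift keeps the
  size of the family.\<close>

definition shift_set :: "'a set set \<Rightarrow> 'a \<Rightarrow> 'a \<Rightarrow> 'a set \<Rightarrow> 'a set" where
  "shift_set A i j E =
    (if j \<in> E \<and> i \<notin> E \<and> insert i (E - {j}) \<notin> A then insert i (E - {j}) else E)"

definition shift :: "'a \<Rightarrow> 'a \<Rightarrow> 'a set set \<Rightarrow> 'a set set" where
  "shift i j A = shift_set A i j ` A"

definition shift_stable :: "'a::linorder set \<Rightarrow> 'a set set \<Rightarrow> bool" where
  "shift_stable Y A \<longleftrightarrow>
    (\<forall>i\<in>Y. \<forall>j\<in>Y. i < j \<longrightarrow> (\<forall>E\<in>A. j \<in> E \<longrightarrow> i \<notin> E \<longrightarrow> insert i (E - {j}) \<in> A))"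

text \<open>Termination measure: every shift towards a smaller point that changes the family lowers
  it.\<close>

definition weight :: "nat set set \<Rightarrow> nat" where
  "weight A = (\<Sum>E\<in>A. \<Sum>E)"

lemma inj_on_shift_set: "inj_on (shift_set A i j) A"
proof (rule inj_onI)
  fix E E' assume "E \<in> A" "E' \<in> A" "shift_set A i j E = shift_set A i j E'"
  moreover have "E = E'" if "j \<in> E" "i \<notin> E" "j \<in> E'" "i \<notin> E'"
      "insert i (E - {j}) = insert i (E' - {j})"
    using that by (metis Diff_insert_absorb insert_Diff Diff_iff)
  ultimately show "E = E'"
    by (auto simp: shift_set_def split: if_splits)
qed

lemma card_shift: "card (shift i j A) = card A"
  unfolding shift_def by (rule card_image[OF inj_on_shift_set])

lemma shift_subset_nsets:
  assumes "A \<subseteq> nsets Y a" "i \<in> Y"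
  shows "shift i j A \<subseteq> nsets Y a"
proof
  fix E assume "E \<in> shift i j A"
  then obtain D where D: "D \<in> A" "E = shift_set A i j D"
    by (auto simp: shift_def)
  have "D \<subseteq> Y" "finite D" "card D = a"
    using D assms by (auto simp: nsets_def)
  moreover have "card (insert i (D - {j})) = card D" if "j \<in> D" "i \<notin> D"
    using that \<open>finite D\<close> by (metis Diff_iff card.remove card_insert_disjoint finite_Diff)
  ultimately show "E \<in> nsets Y a"
    using D assms(2) by (auto simp: nsets_def shift_set_def)
qed

lemma cross_intersecting_sym: "cross_intersecting A B \<Longrightarrow> cross_intersecting B A"
  by (auto simp: cross_intersecting_def Int_commute)

text \<open>If the moved set missed \<open>E'\<close>, then \<open>E\<close> and \<open>E'\<close>
  would share only \<open>j\<close>, and \<open>i\<close> would lie outside \<open>E'\<close>. As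
  the shift leaves \<open>E'\<close> in place, the moved copy of \<open>E'\<close> is already in
  \<open>B\<close>; but \<open>E\<close> misses that copy.\<close>

lemma cross_intersecting_moved:
  assumes "cross_intersecting A B" "E \<in> A" "E' \<in> B" "j \<in> E" "i \<notin> E"
    and "shift_set B i j E' = E'"
  shows "insert i (E - {j}) \<inter> E' \<noteq> {}"
proof
  assume eq: "insert i (E - {j}) \<inter> E' = {}"
  then have "i \<notin> E'" "E \<inter> E' \<subseteq> {j}" by auto
  moreover have "E \<inter> E' \<noteq> {}"
    using assms by (auto simp: cross_intersecting_def)
  ultimately have "j \<in> E'" by auto
  with assms(6) \<open>i \<notin> E'\<close> have "insert i (E' - {j}) \<in> B"
    by (auto simp: shift_set_def split: if_splits)
  then have "E \<inter> insert i (E' - {j}) \<noteq> {}"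
    using assms(1,2) unfolding cross_intersecting_def by blast
  then show False
    using \<open>E \<inter> E' \<subseteq> {j}\<close> \<open>i \<notin> E\<close> by auto
qed

lemma cross_intersecting_shift:
  assumes "cross_intersecting A B"
  shows "cross_intersecting (shift i j A) (shift i j B)"
  unfolding cross_intersecting_def
proof (intro ballI)
  fix D D' assume "D \<in> shift i j A" "D' \<in> shift i j B"
  then obtain E E' where E: "E \<in> A" "D = shift_set A i j E" "E' \<in> B" "D' = shift_set B i j E'"
    by (auto simp: shift_def)
  have moved: "j \<in> E \<and> i \<notin> E \<and> D = insert i (E - {j})" if "D \<noteq> E"
    using that E by (auto simp: shift_set_def split: if_splits)
  have moved': "j \<in> E' \<and> i \<notin> E' \<and> D' = insert i (E' - {j})" if "D' \<noteq> E'"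
    using that E by (auto simp: shift_set_def split: if_splits)
  consider "D = E" "D' = E'" | "D \<noteq> E" "D' = E'" | "D = E" "D' \<noteq> E'" | "D \<noteq> E" "D' \<noteq> E'"
    by blast
  then show "D \<inter> D' \<noteq> {}"
  proof cases
    case 1
    then show ?thesis using E assms by (auto simp: cross_intersecting_def)
  next
    case 2
    then show ?thesis
      using cross_intersecting_moved[OF assms E(1,3), of j i] moved E(4) by auto
  next
    case 3
    then show ?thesis
      using cross_intersecting_moved[OF cross_intersecting_sym[OF assms] E(3,1), of j i] moved' E(2)
      by auto
  next
    case 4
    then show ?thesis using moved moved' by auto
  qed
qed

text \<open>A set that contains \<open>i\<close> after the shift contained \<open>i\<close> or
  \<open>j\<close> before; no other point is ever gained. Hence low degrees can at most
  double.\<close>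

lemma degree_shift_le:
  assumes "finite A" "i \<noteq> j"
  shows "degree (shift i j A) v \<le> (if v = i then degree A i + degree A j else degree A v)"
proof -
  have *: "degree (shift i j A) v \<le> card {E \<in> A. P E}"
    if "\<And>E. E \<in> A \<Longrightarrow> v \<in> shift_set A i j E \<Longrightarrow> P E" for P
  proof -
    have "{E \<in> shift i j A. v \<in> E} \<subseteq> shift_set A i j ` {E \<in> A. P E}"
      using that by (auto simp: shift_def)
    then have "degree (shift i j A) v \<le> card (shift_set A i j ` {E \<in> A. P E})"
      unfolding degree_def using assms(1) by (intro card_mono) auto
    also have "\<dots> \<le> card {E \<in> A. P E}"
      using assms(1) by (intro card_image_le) auto
    finally show ?thesis .
  qed
  show ?thesis
  proof (cases "v = i")
    case True
    have "degree (shift i j A) v \<le> card {E \<in> A. i \<in> E \<or> j \<in> E}"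
      by (rule *) (auto simp: shift_set_def True split: if_splits)
    also have "{E \<in> A. i \<in> E \<or> j \<in> E} = {E \<in> A. i \<in> E} \<union> {E \<in> A. j \<in> E}"
      by auto
    also have "card \<dots> \<le> degree A i + degree A j"
      unfolding degree_def by (rule card_Un_le)
    finally show ?thesis using True by simp
  next
    case False
    have "degree (shift i j A) v \<le> card {E \<in> A. v \<in> E}"
      by (rule *) (use False in \<open>auto simp: shift_set_def split: if_splits\<close>)
    then show ?thesis using False by (simp add: degree_def)
  qed
qed

lemma weight_shift:
  fixes A :: "nat set set"
  assumes "finite A" "\<And>E. E \<in> A \<Longrightarrow> finite E" "i < j"
  shows weight_shift_le: "weight (shift i j A) \<le> weight A"
    and weight_shift_less: "\<lbrakk>E \<in> A; j \<in> E; i \<notin> E; insert i (E - {j}) \<notin> A\<rbrakk>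
      \<Longrightarrow> weight (shift i j A) < weight A"
proof -
  have less: "\<Sum>(insert i (E - {j})) < \<Sum>E" if "E \<in> A" "j \<in> E" "i \<notin> E" for E
    using sum.remove[of E j "\<lambda>x. x"] that assms by simp
  have eq: "weight (shift i j A) = (\<Sum>E\<in>A. \<Sum>(shift_set A i j E))"
    unfolding weight_def shift_def by (simp add: sum.reindex[OF inj_on_shift_set])
  have le: "\<Sum>(shift_set A i j E) \<le> \<Sum>E" if "E \<in> A" for E
    using less[OF that] by (auto simp: shift_set_def less_imp_le)
  show "weight (shift i j A) \<le> weight A"
    unfolding eq unfolding weight_def using le by (rule sum_mono)
  assume E: "E \<in> A" "j \<in> E" "i \<notin> E" "insert i (E - {j}) \<notin> A"
  then have "\<Sum>(shift_set A i j E) < \<Sum>E"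
    using less[of E] by (simp add: shift_set_def)
  then show "weight (shift i j A) < weight A"
    unfolding eq unfolding weight_def using le E(1) assms(1) by (intro sum_strict_mono_ex1) auto
qed

text \<open>Both families undergo the same shifts, so \<open>\<Phi>\<close> may relate them. Since
  the total weight falls, the process ends, and any property that shifts preserve survives.\<close>

lemma shift_until_stable:
  fixes Y :: "nat set"
  assumes "finite Y" and "\<Phi> A B"
    and step: "\<And>A B i j. \<lbrakk>\<Phi> A B; i \<in> Y; j \<in> Y; i < j\<rbrakk> \<Longrightarrow> \<Phi> (shift i j A) (shift i j B)"
    and sub: "\<And>A B. \<Phi> A B \<Longrightarrow> A \<subseteq> Pow Y \<and> B \<subseteq> Pow Y"
  shows "\<exists>A' B'. \<Phi> A' B' \<and> shift_stable Y A' \<and> shift_stable Y B'"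
  using assms(2)
proof (induction "weight A + weight B" arbitrary: A B rule: less_induct)
  case less
  show ?case
  proof (cases "shift_stable Y A \<and> shift_stable Y B")
    case True
    then show ?thesis using less.prems by blast
  next
    case False
    have fin: "finite A" "finite B" "\<And>E. E \<in> A \<Longrightarrow> finite E" "\<And>E. E \<in> B \<Longrightarrow> finite E"
      using sub[OF less.prems] assms(1) by (auto intro: finite_subset)
    from False obtain i j E where ij: "i \<in> Y" "j \<in> Y" "i < j" "j \<in> E" "i \<notin> E"
      and E: "E \<in> A \<and> insert i (E - {j}) \<notin> A \<or> E \<in> B \<and> insert i (E - {j}) \<notin> B"
      unfolding shift_stable_def by blast
    have "weight (shift i j A) + weight (shift i j B) < weight A + weight B"
      using E
    proof
      assume "E \<in> A \<and> insert i (E - {j}) \<notin> A"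
      then show ?thesis
        using weight_shift_less[OF fin(1,3) ij(3), of E] weight_shift_le[OF fin(2,4) ij(3)] ij
        by (auto intro: add_less_le_mono)
    next
      assume "E \<in> B \<and> insert i (E - {j}) \<notin> B"
      then show ?thesis
        using weight_shift_less[OF fin(2,4) ij(3), of E] weight_shift_le[OF fin(1,3) ij(3)] ij
        by (auto intro: add_le_less_mono)
    qed
    from less.hyps[OF this step[OF less.prems ij(1-3)]] show ?thesis .
  qed
qed

section \<open>Lattice paths of shifted families\<close>

text \<open>In terms of paths with an up-step for each chosen point, the two heights add up to at
  least 2 at some prefix. Otherwise the least common point \<open>x\<close> of \<open>E\<close> and
  \<open>E'\<close> could be exchanged in \<open>E\<close> for a smaller free point
  \<open>y\<close>; stability keeps the new set in \<open>A\<close>, and induction on the size of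
  the intersection applies.\<close>

lemma shifted_cross_intersecting:
  fixes Y :: "nat set"
  assumes "finite Y" "shift_stable Y A" "A \<subseteq> Pow Y" "B \<subseteq> Pow Y" "cross_intersecting A B"
    and "E \<in> A" "E' \<in> B"
  shows "\<exists>m. card (Y \<inter> {..m}) + 1 \<le> card (E \<inter> {..m}) + card (E' \<inter> {..m})"
  using assms(6)
proof (induction "card (E \<inter> E')" arbitrary: E rule: less_induct)
  case less
  show ?case
  proof (rule ccontr)
    assume "\<not> ?thesis"
    then have le: "card (E \<inter> {..m}) + card (E' \<inter> {..m}) \<le> card (Y \<inter> {..m})" for m
      by (auto simp: not_le less_Suc_eq_le)
    have Y: "E \<subseteq> Y" "E' \<subseteq> Y" and fin: "finite E" "finite E'"
      using less.prems assms(1,3,4,7) by (auto intro: finite_subset)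
    have ne: "E \<inter> E' \<noteq> {}"
      using assms(5,7) less.prems by (auto simp: cross_intersecting_def)
    define x where "x = Min (E \<inter> E')"
    have x: "x \<in> E" "x \<in> E'"
      using Min_in[of "E \<inter> E'"] ne fin by (auto simp: x_def)
    have minx: "x \<le> v" if "v \<in> E" "v \<in> E'" for v
      using Min_le[of "E \<inter> E'" v] that fin by (auto simp: x_def)
    \<comment> \<open>Up to \<open>x\<close> the two sets have at most as many points as
      \<open>Y\<close>, counted with multiplicity. Since \<open>x\<close> counts twice, they cannot
      cover this prefix.\<close>
    have "\<exists>y\<in>Y. y < x \<and> y \<notin> E \<union> E'"
    proof (rule ccontr)
      assume "\<not> ?thesis"
      then have "Y \<inter> {..x} \<subseteq> (E \<inter> {..x}) \<union> (E' \<inter> {..x})"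
        using x by (auto simp: le_less)
      then have "card (Y \<inter> {..x}) \<le> card ((E \<inter> {..x}) \<union> (E' \<inter> {..x}))"
        by (intro card_mono) auto
      moreover have "card (E \<inter> {..x}) + card (E' \<inter> {..x}) =
          card ((E \<inter> {..x}) \<union> (E' \<inter> {..x})) + card ((E \<inter> {..x}) \<inter> (E' \<inter> {..x}))"
        by (rule card_Un_Int) auto
      moreover have "card ((E \<inter> {..x}) \<inter> (E' \<inter> {..x})) > 0"
        using x by (auto simp: card_gt_0_iff)
      ultimately show False using le[of x] by linarith
    qed
    then obtain y where y: "y \<in> Y" "y < x" "y \<notin> E" "y \<notin> E'" by auto
    define D where "D = insert y (E - {x})"
    have "D \<in> A"
      using assms(2) less.prems y x Y unfolding shift_stable_def D_def by blast
    moreover have "card (D \<inter> E') < card (E \<inter> E')"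
      using x y fin by (intro psubset_card_mono) (auto simp: D_def)
    ultimately obtain m where m: "card (Y \<inter> {..m}) + 1 \<le> card (D \<inter> {..m}) + card (E' \<inter> {..m})"
      using less.hyps[of D] by auto
    \<comment> \<open>The exchange changes the prefix count only for \<open>y \<le> m < x\<close>.
      There \<open>E\<close> and \<open>E'\<close> are still disjoint and both miss
      \<open>y\<close>, so the gain of one still fits into \<open>Y\<close>.\<close>
    consider "m < y" | "y \<le> m" "m < x" | "x \<le> m" by linarith
    then show False
    proof cases
      case 1
      then have "D \<inter> {..m} = E \<inter> {..m}" using y by (auto simp: D_def)
      then show False using m le[of m] by simp
    next
      case 2
      then have "D \<inter> {..m} = insert y (E \<inter> {..m})" by (auto simp: D_def)
      then have D: "card (D \<inter> {..m}) = Suc (card (E \<inter> {..m}))" using y by simp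
      have "(E \<inter> {..m}) \<inter> (E' \<inter> {..m}) = {}" using minx 2 by fastforce
      then have "Suc (card (E \<inter> {..m}) + card (E' \<inter> {..m}))
          = card (insert y ((E \<inter> {..m}) \<union> (E' \<inter> {..m})))"
        using y by (simp add: card_Un_disjoint)
      also have "\<dots> \<le> card (Y \<inter> {..m})"
        using 2 y Y by (intro card_mono) auto
      finally show False using m D by simp
    next
      case 3
      then have "D \<inter> {..m} = insert y ((E \<inter> {..m}) - {x})" using y by (auto simp: D_def)
      then have "card (D \<inter> {..m}) = card (E \<inter> {..m})"
        using y x 3 card_Suc_Diff1[of "E \<inter> {..m}" x] by simp
      then show False using m le[of m] by simp
    qed
  qed
qed

text \<open>The path with an up-step for each point of \<open>E\<close> and a down-step for each other point of \<open>Y\<close>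
  reaches height \<open>t\<close>.\<close>

definition ballot :: "nat set \<Rightarrow> nat \<Rightarrow> nat set \<Rightarrow> bool" where
  "ballot Y t E \<longleftrightarrow> (\<exists>m. card (Y \<inter> {..m}) + t \<le> 2 * card (E \<inter> {..m}))"

lemma card_nsets_binomial: "finite Y \<Longrightarrow> card (nsets Y a) = card Y choose a"
proof -
  assume "finite Y"
  then have "nsets Y a = {E. E \<subseteq> Y \<and> card E = a}"
    by (auto simp: nsets_def dest: finite_subset)
  then show ?thesis using n_subsets[OF \<open>finite Y\<close>] by simp
qed

lemma card_Int_atMost_remove:
  fixes Y :: "nat set"
  assumes "b \<in> Y" "b \<le> m" "finite Y"
  shows "card (Y \<inter> {..m}) = Suc (card ((Y - {b}) \<inter> {..m}))"
proof -
  have "Y \<inter> {..m} = insert b ((Y - {b}) \<inter> {..m})" using assms by auto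
  then show ?thesis using assms by simp
qed

text \<open>The bound of the reflection principle, proved by Pascal's rule on the first step. An
  up-step leaves height \<open>t - 1\<close> to reach with the same \<open>s\<close>; a down-step
  leaves \<open>t + 1\<close> with \<open>s - 1\<close>.\<close>

lemma card_ballot_le:
  assumes "finite Y"
  shows "card {E \<in> nsets Y (s + t). ballot Y t E} \<le> card Y choose s"
  using assms
proof (induction Y arbitrary: s t rule: finite_linorder_min_induct)
  case empty
  have "{E \<in> nsets {} (s + t). ballot {} t E} \<subseteq> (if s = 0 then {{}} else {})"
    by (auto simp: nsets_def ballot_def)
  then have "card {E \<in> nsets {} (s + t). ballot {} t E} \<le> card (if s = 0 then {{}::nat set} else {})"
    by (intro card_mono) auto
  then show ?case by (auto split: if_splits)
next
  case (insert b Y)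
  have b: "b \<notin> Y" using insert by auto
  show ?case
  proof (cases t)
    case 0
    have "card {E \<in> nsets (insert b Y) s. ballot (insert b Y) 0 E} \<le> card (nsets (insert b Y) s)"
      using insert by (intro card_mono finite_imp_finite_nsets) auto
    then show ?thesis
      using insert 0 by (simp add: card_nsets_binomial)
  next
    case (Suc r)
    \<comment> \<open>Before the least point the path is at height 0, which is below
      \<open>t\<close> as \<open>t\<close> is positive here.\<close>
    have low: "b \<le> m" if "card (insert b Y \<inter> {..m}) + t \<le> 2 * card (E \<inter> {..m})"
        "E \<subseteq> insert b Y" for m E
    proof (rule ccontr)
      assume "\<not> b \<le> m"
      then have "E \<inter> {..m} = {}" using that(2) insert.hyps by force
      then show False using that(1) Suc by simp
    qed
    let ?W = "\<lambda>Y s t. {E \<in> nsets Y (s + t). ballot Y t E}"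
    let ?V = "if s = 0 then {} else ?W Y (s - 1) (Suc t)"
    have "?W (insert b Y) s t \<subseteq> insert b ` ?W Y s r \<union> ?V"
    proof
      fix E assume "E \<in> ?W (insert b Y) s t"
      then obtain m where E: "E \<subseteq> insert b Y" "finite E" "card E = s + t"
        and m: "card (insert b Y \<inter> {..m}) + t \<le> 2 * card (E \<inter> {..m})"
        by (auto simp: nsets_def ballot_def)
      have bm: "b \<le> m" using low m E by blast
      have Ym: "card (insert b Y \<inter> {..m}) = Suc (card (Y \<inter> {..m}))"
        using card_Int_atMost_remove[of b "insert b Y" m] bm insert.hyps(1) b by simp
      show "E \<in> insert b ` ?W Y s r \<union> ?V"
      proof (cases "b \<in> E")
        case True
        have "card (E \<inter> {..m}) = Suc (card ((E - {b}) \<inter> {..m}))"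
          using card_Int_atMost_remove True bm E(2) by blast
        then have "ballot Y r (E - {b})"
          using m Ym Suc unfolding ballot_def by (intro exI[of _ m]) simp
        then have "E - {b} \<in> ?W Y s r"
          using E True Suc by (auto simp: nsets_def)
        moreover have "E = insert b (E - {b})" using True by auto
        ultimately show ?thesis by (intro UnI1 image_eqI)
      next
        case False
        then have EY: "E \<subseteq> Y" using E by auto
        have bal: "card (Y \<inter> {..m}) + Suc t \<le> 2 * card (E \<inter> {..m})"
          using m Ym by simp
        \<comment> \<open>With \<open>s = 0\<close> there would be too few up-steps: twice the
          prefix count of \<open>E\<close> is at most that of \<open>Y\<close> plus
          \<open>card E = s + t\<close>, but must exceed that of \<open>Y\<close> by
          \<open>t + 1\<close>.\<close>
        have "card (E \<inter> {..m}) \<le> card (Y \<inter> {..m})" "card (E \<inter> {..m}) \<le> card E"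
          using EY E(2) insert.hyps(1) by (auto intro!: card_mono)
        then have "s \<noteq> 0" using bal E(3) by linarith
        then show ?thesis using E EY bal by (auto simp: nsets_def ballot_def)
      qed
    qed
    then have "card (?W (insert b Y) s t) \<le> card (insert b ` ?W Y s r \<union> ?V)"
      using insert.hyps(1) by (intro card_mono) (auto simp: finite_imp_finite_nsets)
    also have "\<dots> \<le> card (insert b ` ?W Y s r) + card ?V" by (rule card_Un_le)
    also have "card (insert b ` ?W Y s r) \<le> card (?W Y s r)"
      using insert.hyps(1) by (intro card_image_le) (auto simp: finite_imp_finite_nsets)
    also have "\<dots> \<le> card Y choose s" by (rule insert.IH)
    also have "card ?V \<le> (if s = 0 then 0 else card Y choose (s - 1))"
      using insert.IH[of "s - 1" "Suc t"] by (cases s) simp_all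
    also have "(card Y choose s) + (if s = 0 then 0 else card Y choose (s - 1)) = card (insert b Y) choose s"
      using insert.hyps(1) b by (cases s) auto
    finally show ?thesis by simp
  qed
qed

lemma card_le_if_ballot:
  fixes Y :: "nat set"
  assumes "finite Y" "A \<subseteq> nsets Y (s + t)" "\<And>E. E \<in> A \<Longrightarrow> ballot Y t E"
  shows "card A \<le> card Y choose s"
proof -
  have "card A \<le> card {E \<in> nsets Y (s + t). ballot Y t E}"
    using assms by (intro card_mono) (auto simp: finite_imp_finite_nsets)
  also have "\<dots> \<le> card Y choose s" by (rule card_ballot_le[OF assms(1)])
  finally show ?thesis .
qed

section \<open>Size bounds for cross-intersecting families\<close>

lemma nsets_subset_Pow: "A \<subseteq> nsets Y a \<Longrightarrow> A \<subseteq> Pow Y"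
  by (auto simp: nsets_def)

lemma finite_subset_nsets: "A \<subseteq> nsets Y a \<Longrightarrow> finite Y \<Longrightarrow> finite A"
  using finite_imp_finite_nsets finite_subset by blast

lemma ex_shift_stable_cross_intersecting:
  fixes Y :: "nat set"
  assumes "finite Y" "A \<subseteq> nsets Y a" "B \<subseteq> nsets Y b" "cross_intersecting A B"
  obtains A' B' where "A' \<subseteq> nsets Y a" "B' \<subseteq> nsets Y b" "cross_intersecting A' B'"
    "card A' = card A" "card B' = card B" "shift_stable Y A'" "shift_stable Y B'"
proof -
  let ?\<Phi> = "\<lambda>A' B'. A' \<subseteq> nsets Y a \<and> B' \<subseteq> nsets Y b \<and> cross_intersecting A' B' \<and>
    card A' = card A \<and> card B' = card B"
  have "\<exists>A' B'. ?\<Phi> A' B' \<and> shift_stable Y A' \<and> shift_stable Y B'"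
  proof (rule shift_until_stable[OF assms(1)])
    show "?\<Phi> A B" using assms by simp
  qed (simp_all add: shift_subset_nsets cross_intersecting_shift card_shift, meson nsets_subset_Pow)
  then show ?thesis using that by blast
qed

text \<open>After shifting, either every path of the first family reaches height 1, or one of them
  never rises above 0. In the latter case every path of the second family must reach height 2. Both
  alternatives are counted by \<open>card_ballot_le\<close>.\<close>

lemma cross_intersecting_small:
  fixes Y :: "nat set"
  assumes "finite Y" "A \<subseteq> nsets Y (s + 1)" "B \<subseteq> nsets Y (s + 2)" "cross_intersecting A B"
  shows "card A \<le> card Y choose s \<or> card B \<le> card Y choose s"
proof -
  obtain A' B' where AB: "A' \<subseteq> nsets Y (s + 1)" "B' \<subseteq> nsets Y (s + 2)" "cross_intersecting A' B'"
    and card: "card A' = card A" "card B' = card B" and "shift_stable Y A'"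
    using ex_shift_stable_cross_intersecting[OF assms] by metis
  note walk = shifted_cross_intersecting[OF assms(1) \<open>shift_stable Y A'\<close>
      nsets_subset_Pow[OF AB(1)] nsets_subset_Pow[OF AB(2)] AB(3)]
  show ?thesis
  proof (cases "\<forall>E\<in>A'. ballot Y 1 E")
    case True
    then have "card A' \<le> card Y choose s"
      using card_le_if_ballot[OF assms(1) AB(1)] by blast
    then show ?thesis using card by simp
  next
    case False
    then obtain E where E: "E \<in> A'" "\<not> ballot Y 1 E" by blast
    have "ballot Y 2 E'" if E': "E' \<in> B'" for E'
    proof -
      obtain m where "card (Y \<inter> {..m}) + 1 \<le> card (E \<inter> {..m}) + card (E' \<inter> {..m})"
        using walk[OF E(1) E'] by blast
      moreover have "2 * card (E \<inter> {..m}) < card (Y \<inter> {..m}) + 1"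
        using E(2) by (auto simp: ballot_def not_le)
      ultimately have "card (Y \<inter> {..m}) + 2 \<le> 2 * card (E' \<inter> {..m})" by linarith
      then show ?thesis by (auto simp: ballot_def)
    qed
    then have "card B' \<le> card Y choose s"
      using card_le_if_ballot[OF assms(1) AB(2)] by blast
    then show ?thesis using card by simp
  qed
qed

lemma Min_le_of_card_Int_atMost:
  fixes Y :: "nat set"
  assumes "finite Y" "E \<subseteq> Y" "E' \<subseteq> Y" "0 < card (E \<inter> {..m}) + card (E' \<inter> {..m})"
  shows "Min Y \<le> m"
proof -
  have "E \<inter> {..m} \<noteq> {} \<or> E' \<inter> {..m} \<noteq> {}"
    using assms(4) by auto
  then obtain x where "x \<in> Y" "x \<le> m" using assms(2,3) by auto
  then show ?thesis using Min_le[OF assms(1), of x] by linarith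
qed

lemma link_subset_nsets:
  assumes "A \<subseteq> nsets Y (Suc a)"
  shows "link A v \<subseteq> nsets (Y - {v}) a"
  using assms by (auto simp: link_def nsets_def)

lemma avoid_subset_nsets:
  assumes "A \<subseteq> nsets Y a"
  shows "{E \<in> A. v \<notin> E} \<subseteq> nsets (Y - {v}) a"
  using assms by (auto simp: nsets_def)

lemma card_link: "card (link A v) = degree A v"
proof -
  have "link A v = (\<lambda>E. E - {v}) ` {E \<in> A. v \<in> E}"
    by (auto simp: link_def)
  moreover have "inj_on (\<lambda>E. E - {v}) {E \<in> A. v \<in> E}"
    by (rule inj_onI) (metis (lifting) insert_Diff mem_Collect_eq)
  ultimately show ?thesis
    by (simp add: card_image degree_def)
qed

lemma degree_add_avoid:
  assumes "finite A"
  shows "degree A v + card {E \<in> A. v \<notin> E} = card A"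
proof -
  have "A = {E \<in> A. v \<in> E} \<union> {E \<in> A. v \<notin> E}" by auto
  also have "card \<dots> = degree A v + card {E \<in> A. v \<notin> E}"
    unfolding degree_def using assms by (intro card_Un_disjoint) auto
  finally show ?thesis by simp
qed

text \<open>The same dichotomy, applied to the members of \<open>A'\<close> that avoid the least
  point \<open>b\<close>. If their paths on \<open>Y - {b}\<close> all reach height 1, both these
  members and those through \<open>b\<close> are few. Otherwise some path, having stepped down at
  \<open>b\<close>, stays at height at most -1 from there on, which forces height 3 on the whole
  second family.\<close>

lemma cross_intersecting_small_large:
  fixes Y :: "nat set"
  assumes "finite Y" "Y \<noteq> {}" "A \<subseteq> nsets Y (s + 1)" "B \<subseteq> nsets Y (s + 3)"
    and "cross_intersecting A B"
  shows "card A \<le> 2 * (card Y - 1 choose s) \<or> card B \<le> card Y choose s"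
proof -
  obtain A' B' where AB: "A' \<subseteq> nsets Y (s + 1)" "B' \<subseteq> nsets Y (s + 3)" "cross_intersecting A' B'"
    and card: "card A' = card A" "card B' = card B" and "shift_stable Y A'"
    using ex_shift_stable_cross_intersecting[OF assms(1,3-5)] by metis
  note walk = shifted_cross_intersecting[OF assms(1) \<open>shift_stable Y A'\<close>
      nsets_subset_Pow[OF AB(1)] nsets_subset_Pow[OF AB(2)] AB(3)]
  define b where "b = Min Y"
  have b: "b \<in> Y" using assms by (simp add: b_def)
  have cardY: "card (Y - {b}) = card Y - 1" using b assms(1) by simp
  show ?thesis
  proof (cases "\<forall>E\<in>A'. b \<notin> E \<longrightarrow> ballot (Y - {b}) 1 E")
    case True
    have "card {E \<in> A'. b \<notin> E} \<le> card (Y - {b}) choose s"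
      using True assms(1) by (intro card_le_if_ballot[OF _ avoid_subset_nsets[OF AB(1)]]) auto
    moreover have "degree A' b \<le> card (nsets (Y - {b}) s)"
      unfolding card_link[symmetric] using AB(1) assms(1)
      by (intro card_mono link_subset_nsets) (auto simp: finite_imp_finite_nsets)
    moreover have "degree A' b + card {E \<in> A'. b \<notin> E} = card A'"
      using finite_subset_nsets[OF AB(1) assms(1)] by (rule degree_add_avoid)
    ultimately show ?thesis
      using card cardY assms(1) by (simp add: card_nsets_binomial)
  next
    case False
    then obtain E where E: "E \<in> A'" "b \<notin> E" "\<not> ballot (Y - {b}) 1 E" by blast
    have "ballot Y 3 E'" if E': "E' \<in> B'" for E'
    proof -
      obtain m where m: "card (Y \<inter> {..m}) + 1 \<le> card (E \<inter> {..m}) + card (E' \<inter> {..m})"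
        using walk[OF E(1) E'] by blast
      have "E \<subseteq> Y" "E' \<subseteq> Y" using E E' AB by (auto simp: nsets_def)
      then have "b \<le> m"
        using m Min_le_of_card_Int_atMost[OF assms(1), of E E' m] unfolding b_def by linarith
      then have "card (Y \<inter> {..m}) = Suc (card ((Y - {b}) \<inter> {..m}))"
        using card_Int_atMost_remove b assms(1) by blast
      moreover have "2 * card (E \<inter> {..m}) < card ((Y - {b}) \<inter> {..m}) + 1"
        using E(3) by (auto simp: ballot_def not_le)
      ultimately have "card (Y \<inter> {..m}) + 3 \<le> 2 * card (E' \<inter> {..m})" using m by linarith
      then show ?thesis by (auto simp: ballot_def)
    qed
    then have "card B' \<le> card Y choose s"
      using card_le_if_ballot[OF assms(1) AB(2)] by blast
    then show ?thesis using card by simp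
  qed
qed

lemma cross_intersecting_link_avoid:
  assumes "cross_intersecting A B"
  shows "cross_intersecting (link A v) {E \<in> B. v \<notin> E}"
  using assms unfolding cross_intersecting_def link_def by fastforce

text \<open>If both bounds failed, there would be sets \<open>E\<close> and \<open>E'\<close>
  avoiding the least point whose paths stay below height 2 on the rest. The initial down-step brings
  both to height at most 0 on \<open>Y\<close>, but some prefix has height sum at least 2.\<close>

lemma shift_stable_avoid_Min:
  fixes Y :: "nat set"
  assumes "finite Y" "Y \<noteq> {}" "A \<subseteq> nsets Y (s + 2)" "B \<subseteq> nsets Y (s + 2)"
    and "cross_intersecting A B" "shift_stable Y A"
  shows "card {E \<in> A. Min Y \<notin> E} \<le> card Y - 1 choose s \<or> card {E \<in> B. Min Y \<notin> E} \<le> card Y - 1 choose s"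
proof -
  define b where "b = Min Y"
  have b: "b \<in> Y" using assms by (simp add: b_def)
  have cardY: "card (Y - {b}) = card Y - 1" using b assms(1) by simp
  have small: "card {E \<in> C. b \<notin> E} \<le> card Y - 1 choose s"
    if "C \<subseteq> nsets Y (s + 2)" "\<And>E. E \<in> C \<Longrightarrow> b \<notin> E \<Longrightarrow> ballot (Y - {b}) 2 E" for C
    using card_le_if_ballot[OF _ avoid_subset_nsets[OF that(1)], of b] that(2) assms(1) cardY by auto
  show ?thesis
  proof (rule ccontr)
    assume "\<not> ?thesis"
    then obtain E E' where E: "E \<in> A" "b \<notin> E" "\<not> ballot (Y - {b}) 2 E"
      and E': "E' \<in> B" "b \<notin> E'" "\<not> ballot (Y - {b}) 2 E'"
      using small[OF assms(3)] small[OF assms(4)] unfolding b_def by blast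
    obtain m where m: "card (Y \<inter> {..m}) + 1 \<le> card (E \<inter> {..m}) + card (E' \<inter> {..m})"
      using shifted_cross_intersecting[OF assms(1,6) nsets_subset_Pow[OF assms(3)]
          nsets_subset_Pow[OF assms(4)] assms(5) E(1) E'(1)] by blast
    have "E \<subseteq> Y" "E' \<subseteq> Y" using E E' assms(3,4) by (auto simp: nsets_def)
    then have "b \<le> m"
      using m Min_le_of_card_Int_atMost[OF assms(1), of E E' m] unfolding b_def by linarith
    then have "card (Y \<inter> {..m}) = Suc (card ((Y - {b}) \<inter> {..m}))"
      using card_Int_atMost_remove b assms(1) by blast
    moreover have "2 * card (E \<inter> {..m}) < card ((Y - {b}) \<inter> {..m}) + 2"
      "2 * card (E' \<inter> {..m}) < card ((Y - {b}) \<inter> {..m}) + 2"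
      using E(3) E'(3) by (auto simp: ballot_def not_le)
    ultimately show False using m by linarith
  qed
qed

text \<open>A shift at most doubles the largest degree, so it cannot jump over the gap between
  \<open>u\<close> and \<open>card A - u\<close>, where \<open>u = card Y - 1 choose s\<close>, that \<open>cross_intersecting_small\<close> creates; since a vertex of large degree
  exists after shifting, it existed from the start.\<close>

lemma cross_intersecting_common_vertex:
  fixes Y :: "nat set"
  assumes "finite Y" "A \<subseteq> nsets Y (s + 2)" "B \<subseteq> nsets Y (s + 2)" "cross_intersecting A B"
    and "3 * (card Y - 1 choose s) < card A" "3 * (card Y - 1 choose s) < card B"
  shows "\<exists>v\<in>Y. card {E \<in> A. v \<notin> E} \<le> card Y - 1 choose s \<and> card {E \<in> B. v \<notin> E} \<le> card Y - 1 choose s"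
proof (rule ccontr)
  assume no: "\<not> ?thesis"
  define u where "u = card Y - 1 choose s"
  have ne: "Y \<noteq> {}"
  proof
    assume "Y = {}"
    then have "A = {}" using assms(2) by (auto simp: nsets_def)
    then show False using assms(5) by simp
  qed
  have avoid: "degree A' v \<le> u \<or> card {E \<in> B'. v \<notin> E} \<le> u"
    if "A' \<subseteq> nsets Y (s + 2)" "B' \<subseteq> nsets Y (s + 2)" "cross_intersecting A' B'" "v \<in> Y" for A' B' v
  proof -
    have "link A' v \<subseteq> nsets (Y - {v}) (s + 1)"
      using that(1) by (intro link_subset_nsets) simp
    from cross_intersecting_small[OF _ this avoid_subset_nsets[OF that(2)]
        cross_intersecting_link_avoid[OF that(3)]]
    show ?thesis using assms(1) that(4) by (simp add: card_link u_def)
  qed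
  let ?\<Phi> = "\<lambda>A' B'. A' \<subseteq> nsets Y (s + 2) \<and> B' \<subseteq> nsets Y (s + 2) \<and> cross_intersecting A' B' \<and>
    card A' = card A \<and> card B' = card B \<and> (\<forall>v\<in>Y. degree A' v \<le> u \<and> degree B' v \<le> u)"
  \<comment> \<open>If \<open>v\<close> had degree above \<open>u\<close> in one family, at most
    \<open>u\<close> sets of the other would avoid it. The other has more than \<open>3 * u\<close>
    sets, so \<open>v\<close> has large degree there too, and \<open>avoid\<close> applies in the
    opposite direction.\<close>
  have gap: "degree A' v \<le> u \<and> degree B' v \<le> u"
    if "A' \<subseteq> nsets Y (s + 2)" "B' \<subseteq> nsets Y (s + 2)" "cross_intersecting A' B'" "v \<in> Y"
      "card A' = card A" "card B' = card B"
      "\<not> (card {E \<in> A'. v \<notin> E} \<le> u \<and> card {E \<in> B'. v \<notin> E} \<le> u)" for A' B' v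
  proof -
    have "degree A' v + card {E \<in> A'. v \<notin> E} = card A" "degree B' v + card {E \<in> B'. v \<notin> E} = card B"
      using degree_add_avoid finite_subset_nsets[OF _ assms(1)] that by metis+
    then show ?thesis
      using avoid[OF that(1-4)] avoid[OF that(2,1) cross_intersecting_sym[OF that(3)] that(4)]
        assms(5,6) that(7) unfolding u_def by linarith
  qed
  have start: "?\<Phi> A B"
    using gap[OF assms(2-4)] no assms(2-4) unfolding u_def by blast
  have "\<exists>A' B'. ?\<Phi> A' B' \<and> shift_stable Y A' \<and> shift_stable Y B'"
  proof (rule shift_until_stable[where \<Phi> = ?\<Phi>, OF assms(1) start])
    fix A' B' i j assume \<Phi>: "?\<Phi> A' B'" and ij: "i \<in> Y" "j \<in> Y" "i < j"
    have fin: "finite A'" "finite B'" using \<Phi> finite_subset_nsets assms(1) by blast+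
    have AB: "shift i j A' \<subseteq> nsets Y (s + 2)" "shift i j B' \<subseteq> nsets Y (s + 2)"
      "cross_intersecting (shift i j A') (shift i j B')"
      using \<Phi> ij by (simp_all add: shift_subset_nsets cross_intersecting_shift)
    moreover have "degree (shift i j A') v \<le> u \<and> degree (shift i j B') v \<le> u" if v: "v \<in> Y" for v
    proof (rule gap[OF AB v])
      \<comment> \<open>Degrees of at most \<open>2 * u\<close> in a family of more than
        \<open>3 * u\<close> sets leave more than \<open>u\<close> sets avoiding \<open>v\<close>,
        so \<open>gap\<close> brings the degrees back to at most \<open>u\<close>.\<close>
      have "degree A' i \<le> u" "degree A' j \<le> u" "degree A' v \<le> u" using \<Phi> ij v by auto
      then have "degree (shift i j A') v \<le> 2 * u"
        using degree_shift_le[OF fin(1), of i j v] ij by (auto split: if_splits)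
      moreover have "degree (shift i j A') v + card {E \<in> shift i j A'. v \<notin> E} = card A"
        using degree_add_avoid[OF finite_subset_nsets[OF AB(1) assms(1)]] \<Phi> by (simp add: card_shift)
      ultimately show "\<not> (card {E \<in> shift i j A'. v \<notin> E} \<le> u \<and> card {E \<in> shift i j B'. v \<notin> E} \<le> u)"
        using assms(5) unfolding u_def by linarith
    qed (use \<Phi> in \<open>simp_all add: card_shift\<close>)
    ultimately show "?\<Phi> (shift i j A') (shift i j B')" using \<Phi> by (simp add: card_shift)
  qed (meson nsets_subset_Pow)
  then obtain A' B' where \<Phi>: "?\<Phi> A' B'" and st: "shift_stable Y A'" by blast
  have "degree A' (Min Y) + card {E \<in> A'. Min Y \<notin> E} = card A"
    "degree B' (Min Y) + card {E \<in> B'. Min Y \<notin> E} = card B"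
    using \<Phi> degree_add_avoid finite_subset_nsets[OF _ assms(1)] by metis+
  moreover have "degree A' (Min Y) \<le> u" "degree B' (Min Y) \<le> u"
    using \<Phi> Min_in[OF assms(1) ne] by auto
  moreover have "card {E \<in> A'. Min Y \<notin> E} \<le> u \<or> card {E \<in> B'. Min Y \<notin> E} \<le> u"
    unfolding u_def using \<Phi> st by (intro shift_stable_avoid_Min[OF assms(1) ne]) auto
  ultimately show False using assms(5,6) unfolding u_def by linarith
qed

section \<open>Degrees and codegrees in balanced families\<close>

lemma degree_link:
  assumes "a \<noteq> b"
  shows "degree (link A a) b = card {E \<in> A. a \<in> E \<and> b \<in> E}"
proof -
  have "{E \<in> link A a. b \<in> E} = link {E \<in> A. b \<in> E} a"
    using assms by (auto simp: link_def)
  then have "degree (link A a) b = degree {E \<in> A. b \<in> E} a"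
    by (metis card_link degree_def)
  also have "\<dots> = card {E \<in> A. a \<in> E \<and> b \<in> E}"
    by (auto simp: degree_def intro: arg_cong[where f = card])
  finally show ?thesis .
qed

lemma degree_split:
  assumes "finite A"
  shows "degree A a = card {E \<in> A. a \<in> E \<and> b \<in> E} + degree {E \<in> A. b \<notin> E} a"
proof -
  have "{E \<in> A. a \<in> E} = {E \<in> A. a \<in> E \<and> b \<in> E} \<union> {E \<in> {E \<in> A. b \<notin> E}. a \<in> E}"
    by auto
  then show ?thesis
    unfolding degree_def using assms by (simp add: card_Un_disjoint disjoint_iff)
qed

lemma degree_sum_avoid:
  assumes "finite A"
  shows "degree A a + degree A b + card {E \<in> A. a \<notin> E \<and> b \<notin> E}
    = card A + card {E \<in> A. a \<in> E \<and> b \<in> E}"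
proof -
  have "degree {E \<in> A. b \<notin> E} a + card {E \<in> {E \<in> A. b \<notin> E}. a \<notin> E} = card {E \<in> A. b \<notin> E}"
    using assms by (intro degree_add_avoid) simp
  moreover have "{E \<in> {E \<in> A. b \<notin> E}. a \<notin> E} = {E \<in> A. a \<notin> E \<and> b \<notin> E}" by auto
  ultimately show ?thesis
    using degree_add_avoid[OF assms, of b] degree_split[OF assms, of a b] by simp
qed

text \<open>The shape of a counterexample apart from its size, stated without division.\<close>

definition balanced :: "nat \<Rightarrow> nat \<Rightarrow> nat set set \<Rightarrow> bool" where
  "balanced n k A \<longleftrightarrow> A \<subseteq> nsets {1..n} k \<and> intersecting A \<and> (\<forall>v\<in>{1..n}. 2 * degree A v \<le> card A)"

text \<open>As two degrees sum to at most \<open>card A\<close>, inclusion-exclusion makes the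
  codegree at most the number of sets avoiding both points. So whichever of the two
  cross-intersecting families is small, the codegree is small.\<close>

lemma balanced_codegree_le:
  assumes "balanced n (s + 3) A" "2 * (s + 3) \<le> n" "a \<in> {1..n}" "b \<in> {1..n}" "a \<noteq> b"
  shows "card {E \<in> A. a \<in> E \<and> b \<in> E} \<le> 2 * (n - 3 choose s)"
proof -
  have A: "A \<subseteq> nsets {1..n} (s + 3)" "cross_intersecting A A"
    and deg: "2 * degree A a \<le> card A" "2 * degree A b \<le> card A"
    using assms by (auto simp: balanced_def intersecting_def cross_intersecting_def)
  have fin: "finite A" using finite_subset_nsets[OF A(1)] by simp
  let ?Y = "{1..n} - {a} - {b}"
  let ?L = "link (link A a) b"
  let ?B = "{E \<in> {E \<in> A. a \<notin> E}. b \<notin> E}"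
  have Y: "card ?Y = n - 2" using assms(3-5) by simp
  then have "0 < card ?Y" using assms(2) by simp
  then have "?Y \<noteq> {}" using card_gt_0_iff by blast
  moreover have "?L \<subseteq> nsets ?Y (s + 1)"
    using A(1) by (intro link_subset_nsets) (simp add: numeral_3_eq_3)
  moreover have "?B \<subseteq> nsets ?Y (s + 3)"
    using A(1) by (intro avoid_subset_nsets)
  moreover have "cross_intersecting ?L ?B"
    using A(2) by (intro cross_intersecting_link_avoid)
  ultimately have "card ?L \<le> 2 * (card ?Y - 1 choose s) \<or> card ?B \<le> card ?Y choose s"
    by (intro cross_intersecting_small_large) auto
  moreover have "card ?L = card {E \<in> A. a \<in> E \<and> b \<in> E}"
    using assms(5) by (simp add: card_link degree_link)
  moreover have "?B = {E \<in> A. a \<notin> E \<and> b \<notin> E}" by auto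
  \<comment> \<open>Pascal's rule, with \<open>s\<close> in the increasing half of the row
    \<open>n - 3\<close>.\<close>
  moreover have "n - 2 choose s \<le> 2 * (n - 3 choose s)"
  proof (cases s)
    case (Suc r)
    have "n - 2 = Suc (n - 3)" using assms(2) by simp
    then have "n - 2 choose s = (n - 3 choose r) + (n - 3 choose s)" using Suc by simp
    moreover have "n - 3 choose r \<le> n - 3 choose s"
      using assms(2) Suc by (intro binomial_mono) auto
    ultimately show ?thesis by simp
  qed simp
  ultimately show ?thesis
    using degree_sum_avoid[OF fin, of a b] deg Y by auto
qed

text \<open>The 5 is 2 + 3: removing a codegree of at most \<open>2 * u\<close> leaves more than the
  \<open>3 * u\<close> sets that \<open>cross_intersecting_common_vertex\<close> requires. All but
  \<open>u\<close> of those through \<open>a\<close> then contain \<open>v\<close>, so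
  \<open>a\<close> and \<open>v\<close> would have codegree above \<open>2 * u\<close>.\<close>

lemma balanced_degree_small:
  assumes "balanced n (s + 3) A" "2 * (s + 3) \<le> n" "a \<in> {1..n}" "b \<in> {1..n}" "a \<noteq> b"
  shows "degree A a \<le> 5 * (n - 3 choose s) \<or> degree A b \<le> 5 * (n - 3 choose s)"
proof (rule ccontr)
  assume large: "\<not> ?thesis"
  define u where "u = n - 3 choose s"
  have A: "A \<subseteq> nsets {1..n} (s + 3)" "intersecting A"
    using assms by (auto simp: balanced_def)
  have fin: "finite A" using finite_subset_nsets[OF A(1)] by simp
  note codegree = balanced_codegree_le[OF assms(1,2), folded u_def]
  let ?Y = "{1..n} - {a} - {b}"
  let ?B = "\<lambda>a b. link {E \<in> A. b \<notin> E} a"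
  have Y: "card ?Y - 1 = n - 3" using assms(3-5) by simp
  have sub: "?B a b \<subseteq> nsets ({1..n} - {b} - {a}) (s + 2)" for a b
    using avoid_subset_nsets[OF A(1), of b] by (intro link_subset_nsets) (simp add: numeral_3_eq_3)
  have card: "card (?B a b) + card {E \<in> A. a \<in> E \<and> b \<in> E} = degree A a" for a b
    using degree_split[OF fin, of a b] by (simp add: card_link)
  have "cross_intersecting (?B a b) (?B b a)"
    using A(2) unfolding cross_intersecting_def intersecting_def link_def by fastforce
  moreover have "3 * u < card (?B a b)" "3 * u < card (?B b a)"
    using card[of a b] card[of b a] codegree[of a b] codegree[of b a] assms(3-5) large
    unfolding u_def by fastforce+
  moreover have "?B a b \<subseteq> nsets ?Y (s + 2)" "?B b a \<subseteq> nsets ?Y (s + 2)"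
    using sub[of a b] sub[of b a] by (simp_all add: Diff_insert[symmetric] insert_commute)
  ultimately obtain v where v: "v \<in> ?Y" "card {E \<in> ?B a b. v \<notin> E} \<le> u"
    using cross_intersecting_common_vertex[of ?Y "?B a b" s "?B b a"] unfolding Y u_def by blast
  have "degree (?B a b) v + card {E \<in> ?B a b. v \<notin> E} = card (?B a b)"
    using finite_subset_nsets[OF sub] by (intro degree_add_avoid) simp
  moreover have "degree (?B a b) v \<le> 2 * u"
  proof -
    have "degree (?B a b) v = card {E \<in> {E \<in> A. b \<notin> E}. a \<in> E \<and> v \<in> E}"
      using v by (intro degree_link) auto
    also have "\<dots> \<le> card {E \<in> A. a \<in> E \<and> v \<in> E}"
      using fin by (intro card_mono) auto
    also have "\<dots> \<le> 2 * u"
      using v assms(3) by (intro codegree) auto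
    finally show ?thesis .
  qed
  ultimately show False using v(2) \<open>3 * u < card (?B a b)\<close> by linarith
qed

lemma card_lt_if_balanced:
  assumes "balanced n (s + 3) A" "2 * (s + 3) \<le> n"
  shows "card A < 36 * (n - 3 choose s)"
proof (rule ccontr)
  assume large: "\<not> ?thesis"
  define u where "u = n - 3 choose s"
  have large: "36 * u \<le> card A" using large by (simp add: u_def)
  \<comment> \<open>Excludes the empty family, which would satisfy every inequality below.\<close>
  have "0 < u" using assms(2) by (simp add: u_def)
  let ?P = "\<lambda>F. balanced n (s + 3) F \<and> card F = card A"
  \<comment> \<open>A balanced family of the same size with least weight: any shift that changes it
    and keeps it balanced gives a contradiction.\<close>
  obtain F where F: "balanced n (s + 3) F" "card F = card A"
    and min: "\<And>F'. balanced n (s + 3) F' \<Longrightarrow> card F' = card A \<Longrightarrow> weight F \<le> weight F'"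
    using ex_has_least_nat[of ?P A weight] assms(1) by blast
  have sub: "F \<subseteq> nsets {1..n} (s + 3)" and int: "intersecting F"
    and half: "\<And>v. v \<in> {1..n} \<Longrightarrow> 2 * degree F v \<le> card F"
    using F(1) by (auto simp: balanced_def)
  have fin: "finite F" "\<And>E. E \<in> F \<Longrightarrow> finite E"
    using finite_subset_nsets[OF sub] sub by (auto simp: nsets_def)
  obtain z where z: "z \<in> {1..n}" and low: "\<And>v. v \<in> {1..n} - {z} \<Longrightarrow> degree F v \<le> 5 * u"
  proof (cases "\<exists>z\<in>{1..n}. degree F z > 5 * u")
    case True
    then obtain z where z: "z \<in> {1..n}" "degree F z > 5 * u" by blast
    have "degree F v \<le> 5 * u" if "v \<in> {1..n} - {z}" for v
      using balanced_degree_small[OF F(1) assms(2) z(1), of v] that z(2) by (auto simp: u_def)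
    with z(1) show ?thesis by (rule that)
  next
    \<comment> \<open>Without a point of large degree, any point may play the part of
      \<open>z\<close>.\<close>
    case False
    have "1 \<in> {1..n}" using assms(2) by simp
    with False show ?thesis by (intro that[of 1]) (auto simp: not_less)
  qed
  define Y where "Y = {1..n} - {z}"
  have Y: "finite Y" "card Y = n - 1" using z by (simp_all add: Y_def)
  \<comment> \<open>Only the degree of \<open>i\<close> can grow, to at most \<open>10 * u\<close>,
    and twice that is below \<open>36 * u\<close>. Shifts within \<open>Y\<close> never add to the
    degree of \<open>z\<close>.\<close>
  have stable: "insert i (E - {j}) \<in> F" if "i \<in> Y" "j \<in> Y" "i < j" "E \<in> F" "j \<in> E" "i \<notin> E" for i j E
  proof (rule ccontr)
    assume "insert i (E - {j}) \<notin> F"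
    then have "weight (shift i j F) < weight F"
      using weight_shift_less[OF fin that(3)] that by blast
    moreover have "balanced n (s + 3) (shift i j F)"
      unfolding balanced_def
    proof (intro conjI ballI)
      show "shift i j F \<subseteq> nsets {1..n} (s + 3)"
        using sub that(1) by (intro shift_subset_nsets) (auto simp: Y_def)
      show "intersecting (shift i j F)"
        using cross_intersecting_shift[of F F i j] int
        by (simp add: intersecting_def cross_intersecting_def)
      fix v assume "v \<in> {1..n}"
      moreover have "degree F i \<le> 5 * u" "degree F j \<le> 5 * u"
        using low that(1,2) by (auto simp: Y_def)
      ultimately show "2 * degree (shift i j F) v \<le> card (shift i j F)"
        using degree_shift_le[OF fin(1), of i j v] that(3) half[of v] large F(2)
        by (auto simp: card_shift split: if_splits)
    qed
    ultimately show False using min[of "shift i j F"] F(2) by (simp add: card_shift)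
  qed
  define G where "G = {E \<in> F. z \<notin> E}"
  have G: "G \<subseteq> nsets Y (s + 3)"
    using avoid_subset_nsets[OF sub] by (simp add: G_def Y_def)
  have Gst: "shift_stable Y G"
    using stable by (auto simp: shift_stable_def G_def Y_def)
  have Gint: "cross_intersecting G G"
    using int by (auto simp: intersecting_def cross_intersecting_def G_def)
  define b where "b = Min Y"
  define c where "c = Min (Y - {b})"
  have b: "b \<in> Y" unfolding b_def using Y assms(2) by (intro Min_in) auto
  have Yb: "card (Y - {b}) = n - 2" "finite (Y - {b})" using Y b by simp_all
  have "0 < card (Y - {b})" using Yb assms(2) by simp
  then have c: "c \<in> Y - {b}" unfolding c_def using Yb card_gt_0_iff by (intro Min_in) blast+
  have Yc: "card (Y - {b} - {c}) = n - 3" using Yb c by simp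
  define H where "H = {E \<in> {E \<in> G. b \<notin> E}. c \<notin> E}"
  have H: "H \<subseteq> nsets (Y - {b} - {c}) (s + 3)"
    unfolding H_def by (intro avoid_subset_nsets G)
  \<comment> \<open>Paired with itself, \<open>E\<close> reaches height 1 on \<open>Y\<close>. Its
    first two steps, at \<open>b\<close> and \<open>c\<close>, go down, so the remaining steps climb
    by 3.\<close>
  have "ballot (Y - {b} - {c}) 3 E" if E: "E \<in> H" for E
  proof -
    have EG: "E \<in> G" and EY: "E \<subseteq> Y - {b}" using E H by (auto simp: H_def nsets_def)
    obtain m where m: "card (Y \<inter> {..m}) + 1 \<le> card (E \<inter> {..m}) + card (E \<inter> {..m})"
      using shifted_cross_intersecting[OF Y(1) Gst nsets_subset_Pow[OF G] nsets_subset_Pow[OF G] Gint EG EG]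
      by blast
    have bm: "b \<le> m"
      using Min_le_of_card_Int_atMost[OF Y(1), of E E m] EY m unfolding b_def by fastforce
    have cm: "c \<le> m"
      using Min_le_of_card_Int_atMost[OF Yb(2) EY EY, of m] m unfolding c_def by linarith
    have "card (Y \<inter> {..m}) = Suc (Suc (card ((Y - {b} - {c}) \<inter> {..m})))"
      using card_Int_atMost_remove[OF b bm Y(1)] card_Int_atMost_remove[OF c cm Yb(2)] by simp
    then have "card ((Y - {b} - {c}) \<inter> {..m}) + 3 \<le> 2 * card (E \<inter> {..m})" using m by linarith
    then show ?thesis unfolding ballot_def by blast
  qed
  then have "card H \<le> u"
    using card_le_if_ballot[OF _ H] Yb(2) Yc by (simp add: u_def)
  moreover have "card F \<le> degree F z + degree F b + degree F c + card H"
  proof -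
    have "F \<subseteq> ({E \<in> F. z \<in> E} \<union> {E \<in> F. b \<in> E} \<union> {E \<in> F. c \<in> E}) \<union> H"
      by (auto simp: G_def H_def)
    then have "card F \<le> card (({E \<in> F. z \<in> E} \<union> {E \<in> F. b \<in> E} \<union> {E \<in> F. c \<in> E}) \<union> H)"
      using fin(1) by (intro card_mono) (auto simp: G_def H_def)
    also have "\<dots> \<le> degree F z + degree F b + degree F c + card H"
      unfolding degree_def by (meson add_le_mono1 card_Un_le le_trans)
    finally show ?thesis .
  qed
  moreover have "degree F b \<le> 5 * u" "degree F c \<le> 5 * u"
    using low b c by (auto simp: Y_def)
  \<comment> \<open>Altogether \<open>card F \<le> card F / 2 + 5 * u + 5 * u + u\<close>, that is,
    at most \<open>22 * u\<close>.\<close>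
  ultimately show False using half[OF z] large F(2) \<open>0 < u\<close> by linarith
qed

section \<open>Uniformity one and two, and the conclusion\<close>

text \<open>All sets meet a fixed member \<open>{a, b}\<close>, where \<open>a = b\<close> is
  allowed. Hence the degrees of \<open>a\<close> and \<open>b\<close> sum to \<open>card A\<close>
  plus their codegree, which is positive because of that member.\<close>

lemma not_balanced_small_uniformity:
  assumes "A \<noteq> {}" "1 \<le> k" "k \<le> 2"
  shows "\<not> balanced n k A"
proof
  assume "balanced n k A"
  then have sub: "A \<subseteq> nsets {1..n} k" and int: "intersecting A"
    and half: "\<And>v. v \<in> {1..n} \<Longrightarrow> 2 * degree A v \<le> card A"
    by (auto simp: balanced_def)
  have fin: "finite A" using finite_subset_nsets[OF sub] by simp
  obtain E where E: "E \<in> A" using assms(1) by blast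
  then have "E \<subseteq> {1..n}" "card E = 1 \<or> card E = 2" using sub assms(2,3) by (auto simp: nsets_def)
  then obtain a b where ab: "E = {a, b}" "a \<in> {1..n}" "b \<in> {1..n}"
    by (auto simp: card_1_singleton_iff card_2_iff)
  have none: "{F \<in> A. a \<notin> F \<and> b \<notin> F} = {}"
    using int E ab(1) by (auto simp: intersecting_def)
  have "card {F \<in> A. a \<in> F \<and> b \<in> F} > 0"
    using fin E ab(1) by (auto simp: card_gt_0_iff)
  moreover have "degree A a + degree A b = card A + card {F \<in> A. a \<in> F \<and> b \<in> F}"
    using degree_sum_avoid[OF fin, of a b] unfolding none by simp
  ultimately show False using half[OF ab(2)] half[OF ab(3)] by linarith
qed

theorem theorem1p7:
  fixes n k :: nat and \<F> :: "nat set set"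
  assumes "n \<ge> 1" and "k \<ge> 1" and "n \<ge> 2 * k"
    and "\<F> \<subseteq> nsets {1..n} k"
    and "\<F> \<noteq> {}"
    and "intersecting \<F>"
    and "card \<F> \<ge> 36 * ibinomial (int n - 3) (int k - 3)"
  shows "max_degree_ratio n \<F> > 1 / 2"
proof (rule ccontr)
  assume small: "\<not> max_degree_ratio n \<F> > 1 / 2"
  have pos: "0 < card \<F>"
    using finite_subset_nsets[OF assms(4)] assms(5) by (simp add: card_gt_0_iff)
  have "2 * degree \<F> v \<le> card \<F>" if "v \<in> {1..n}" for v
  proof -
    have "real (card (link \<F> v)) / real (card \<F>) \<le> max_degree_ratio n \<F>"
      unfolding max_degree_ratio_def using that by (intro Max_ge) auto
    then have "real (degree \<F> v) / real (card \<F>) \<le> 1 / 2"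
      using small unfolding card_link by linarith
    then have "real (2 * degree \<F> v) \<le> real (card \<F>)"
      using pos by (simp add: field_simps)
    then show ?thesis by linarith
  qed
  then have bal: "balanced n k \<F>"
    using assms by (simp add: balanced_def)
  show False
  \<comment> \<open>For \<open>k \<le> 2\<close> the assumed lower bound on the size is 0, so these
    cases rest on nonemptiness alone.\<close>
  proof (cases "k \<le> 2")
    case True
    then show False using not_balanced_small_uniformity bal assms(2,5) by blast
  next
    case False
    define s where "s = k - 3"
    with False have k: "k = s + 3" by simp
    have "ibinomial (int n - 3) (int k - 3) = n - 3 choose s"
      using assms(3) k by (auto simp: ibinomial_def nat_diff_distrib)
    then show False
      using card_lt_if_balanced[of n s \<F>] bal k assms(3,7) by simp
  qed
qed

end
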